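(* Let $a_{ij}, b_i, c_i$ ($i,j\in[s]$) be the coefficients of an $s$-stage Runge--Kutta method with $b_i\neq 0$ for all $i\in[s]$, and suppose that every step-size $h_n=t_{n+1}-t_n>0$, $n=0,\dots,N-1$, satisfies $$h_n<\frac{1}{L\,\max_{i=1,\dots,s}\sum_{j=1}^s|a_{ij}|}.$$ For $p\in\mathbb{R}^{n_p}$ let $x_N(p)$ be the final iterate of the Runge--Kutta scheme $$x_{n+1}=x_n+h_n\sum_{i=1}^s b_i k_{n,i},\qquad k_{n,i}=f(X_{n,i},p,t_n+c_ih_n),\qquad X_{n,i}=x_n+h_n\sum_{j=1}^s a_{ij}k_{n,j},\qquad i\in[s],\ n=0,\dots,N-1,$$ started at the fixed initial value $x_0\in\mathbb{R}^{n_x}$. Then the gradient of the function $\Phi(p)=\mathcal{C}(x_N(p))$ with respect to $p$ is given by $$\partial\Phi(p)=\sum_{n=0}^{N-1}h_n\sum_{i=1}^s\overline b_i\,\big(d_pf(X_{n,i},p,t_n+\overline c_ih_n)\big)^\top\Lambda_{n,i},$$ where the discrete adjoint variables are given by $\lambda_N=\partial\mathcal{C}(x_N(p))$ and, for $n=0,\dots,N-1$ and $i\in[s]$, $$\lambda_{n+1}=\lambda_n+h_n\sum_{i=1}^s\overline b_i\,\ell_{n,i},\qquad \ell_{n,i}=-d_xf(X_{n,i},p,t_n+\overline c_ih_n)^\top\Lambda_{n,i},\qquad \Lambda_{n,i}=\lambda_n+h_n\sum_{j=1}^s\overline a_{ij}\,\ell_{n,j}.$$ This is the general Runge--Kutta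 scheme applied to the adjoint system $\dot\lambda(t)=-d_xf(x(t),p,t)^\top\lambda(t)$, $\lambda(T)=\partial\mathcal{C}(x(T))$ (with $x(\cdot)$ represented by the internal stages $X_{n,i}$), with the coefficients $$\overline a_{ij}=b_j-\frac{a_{ji}b_j}{b_i},\qquad \overline b_i=b_i,\qquad \overline c_i=c_i,\qquad i,j\in[s].$$
   Context: Notation: $[s]=\{1,\dots,s\}$; $\partial$ denotes the Euclidean gradient (a column vector); $d_xf\in\mathbb{R}^{n_x\times n_x}$ and $d_pf\in\mathbb{R}^{n_x\times n_p}$ denote the Jacobians of $f(x,p,t)$ with respect to $x$ and $p$. Setting: $0=t_0<t_1<\dots<t_N=T$ is a time grid. The function $\mathcal{C}\colon\mathbb{R}^{n_x}\to\mathbb{R}$ is smooth. The vector field $f(x,p,t)\in\mathbb{R}^{n_x}$, $x\in\mathbb{R}^{n_x}$, $p\in\mathbb{R}^{n_p}$, $t\in[0,T]$, is such that $f(\cdot,p,\cdot)$ is Lipschitz continuous on $\mathbb{R}^{n_x}\times[0,T]$ with a constant $L$ independent of $p$, and the derivatives $d_xf$, $d_pf$ exist and are continuous. The evaluation times $t_n+c_ih_n$ are understood to lie in the time domain of $f$. The initial value $x_0$ does not depend on $p$. The underlying continuous problem is $\dot x(t)=f(x(t),p,t)$, $x(0)=x_0$, $t\in[0,T]$. Under the step-size condition (which is void if all $a_{ij}=0$), the possibly implicit equations for $k_{n,i}$ have a unique solution, so $x_N(p)$ is well defined. *)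

theory Defs
  imports "HOL-Analysis.Analysis"
begin

text \<open>Smoothness of a function on the whole space, i.e. of class \<open>C\<^sup>k\<close> for all \<open>k\<close>.
  The derivative is handled through its directional values \<open>x \<mapsto> Df(x) v\<close>; on a
  finite-dimensional domain this gives the usual notion.\<close>

primrec Ck_class :: "nat \<Rightarrow> ('v::real_normed_vector \<Rightarrow> 'w::real_normed_vector) \<Rightarrow> bool" where
  "Ck_class 0 g \<longleftrightarrow> continuous_on UNIV g"
| "Ck_class (Suc k) g \<longleftrightarrow> (\<forall>x. g differentiable (at x)) \<and>
     (\<forall>v. Ck_class k (\<lambda>x. frechet_derivative g (at x) v))"

definition smooth :: "('v::real_normed_vector \<Rightarrow> 'w::real_normed_vector) \<Rightarrow> bool" where
  "smooth g \<longleftrightarrow> (\<forall>k. Ck_class k g)"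

definition d_x :: "(real^'nx \<Rightarrow> real^'np \<Rightarrow> real \<Rightarrow> real^'nx) \<Rightarrow>
    real^'nx \<Rightarrow> real^'np \<Rightarrow> real \<Rightarrow> real^'nx^'nx" where
  "d_x f x p \<tau> = jacobian (\<lambda>y. f y p \<tau>) (at x)"

definition d_p :: "(real^'nx \<Rightarrow> real^'np \<Rightarrow> real \<Rightarrow> real^'nx) \<Rightarrow>
    real^'nx \<Rightarrow> real^'np \<Rightarrow> real \<Rightarrow> real^'np^'nx" where
  "d_p f x p \<tau> = jacobian (\<lambda>q. f x q \<tau>) (at p)"

definition step :: "(nat \<Rightarrow> real) \<Rightarrow> nat \<Rightarrow> real" where
  "step t n = t (Suc n) - t n"

text \<open>The equations of the general (possibly implicit) Runge--Kutta scheme with coefficients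
  \<open>a\<close>, \<open>b\<close>, \<open>c\<close> on the grid \<open>t 0, \<dots>, t N\<close>, for the iterates \<open>y n\<close> (\<open>n \<le> N\<close>), the slopes \<open>k n i\<close>
  and the internal stages \<open>Y n i\<close>; the stages are indexed by the finite type \<open>'s\<close>. No initial
  or terminal value is imposed. The vector field \<open>g n i y \<tau>\<close> may depend on the step \<open>n\<close> and the
  stage \<open>i\<close>: the adjoint system is linearised along \<open>x(\<cdot>)\<close>, which in stage \<open>i\<close> of step \<open>n\<close> is
  represented by the forward stage \<open>X n i\<close>.\<close>

definition rk_scheme ::
    "('s::finite \<Rightarrow> 's \<Rightarrow> real) \<Rightarrow> ('s \<Rightarrow> real) \<Rightarrow> ('s \<Rightarrow> real) \<Rightarrow> (nat \<Rightarrow> real) \<Rightarrow> nat \<Rightarrow>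
     (nat \<Rightarrow> 's \<Rightarrow> 'v::real_vector \<Rightarrow> real \<Rightarrow> 'v) \<Rightarrow>
     (nat \<Rightarrow> 'v) \<Rightarrow> (nat \<Rightarrow> 's \<Rightarrow> 'v) \<Rightarrow> (nat \<Rightarrow> 's \<Rightarrow> 'v) \<Rightarrow> bool" where
  "rk_scheme a b c t N g y k Y \<longleftrightarrow>
     (\<forall>n<N. y (Suc n) = y n + step t n *\<^sub>R (\<Sum>i\<in>UNIV. b i *\<^sub>R k n i) \<and>
       (\<forall>i. k n i = g n i (Y n i) (t n + c i * step t n)) \<and>
       (\<forall>i. Y n i = y n + step t n *\<^sub>R (\<Sum>j\<in>UNIV. a i j *\<^sub>R k n j)))"

definition forward_rk ::
    "('s::finite \<Rightarrow> 's \<Rightarrow> real) \<Rightarrow> ('s \<Rightarrow> real) \<Rightarrow> ('s \<Rightarrow> real) \<Rightarrow> (nat \<Rightarrow> real) \<Rightarrow> nat \<Rightarrow>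
     (real^'nx \<Rightarrow> real^'np \<Rightarrow> real \<Rightarrow> real^'nx) \<Rightarrow> real^'nx \<Rightarrow> real^'np \<Rightarrow>
     (nat \<Rightarrow> real^'nx) \<Rightarrow> (nat \<Rightarrow> 's \<Rightarrow> real^'nx) \<Rightarrow> (nat \<Rightarrow> 's \<Rightarrow> real^'nx) \<Rightarrow> bool" where
  "forward_rk a b c t N f x0 p x k X \<longleftrightarrow>
     x 0 = x0 \<and> rk_scheme a b c t N (\<lambda>n i y \<tau>. f y p \<tau>) x k X"

definition rk_final ::
    "('s::finite \<Rightarrow> 's \<Rightarrow> real) \<Rightarrow> ('s \<Rightarrow> real) \<Rightarrow> ('s \<Rightarrow> real) \<Rightarrow> (nat \<Rightarrow> real) \<Rightarrow> nat \<Rightarrow>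
     (real^'nx \<Rightarrow> real^'np \<Rightarrow> real \<Rightarrow> real^'nx) \<Rightarrow> real^'nx \<Rightarrow> real^'np \<Rightarrow> real^'nx" where
  "rk_final a b c t N f x0 p = (THE z. \<exists>x k X. forward_rk a b c t N f x0 p x k X \<and> z = x N)"

text \<open>The scheme applied to the adjoint system, with coefficients \<open>a\<close>, \<open>b\<close>, \<open>c\<close> of its own and
  terminal value \<open>\<lambda>\<^sub>N = \<partial>C(z)\<close>; \<open>z\<close> stands for the final forward iterate and \<open>X\<close> for the
  forward stages.\<close>

definition adjoint_rk ::
    "('s::finite \<Rightarrow> 's \<Rightarrow> real) \<Rightarrow> ('s \<Rightarrow> real) \<Rightarrow> ('s \<Rightarrow> real) \<Rightarrow> (nat \<Rightarrow> real) \<Rightarrow> nat \<Rightarrow>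
     (real^'nx \<Rightarrow> real^'np \<Rightarrow> real \<Rightarrow> real^'nx) \<Rightarrow> (real^'nx \<Rightarrow> real) \<Rightarrow> real^'np \<Rightarrow>
     real^'nx \<Rightarrow> (nat \<Rightarrow> 's \<Rightarrow> real^'nx) \<Rightarrow>
     (nat \<Rightarrow> real^'nx) \<Rightarrow> (nat \<Rightarrow> 's \<Rightarrow> real^'nx) \<Rightarrow> (nat \<Rightarrow> 's \<Rightarrow> real^'nx) \<Rightarrow> bool" where
  "adjoint_rk a b c t N f C p z X lam l Lam \<longleftrightarrow>
     (GDERIV C z :> lam N) \<and>
     rk_scheme a b c t N (\<lambda>n i \<mu> \<tau>. - (transpose (d_x f (X n i) p \<tau>) *v \<mu>)) lam l Lam"

end

theory Submission
  imports Defs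
begin

text \<open>The step-size condition makes the stage equations of each step a contraction in the maximum
  norm over the stages, so they are uniquely solvable, and by the inverse function theorem their
  solution depends differentiably on \<open>p\<close>. Let \<open>\<delta> n v\<close>, \<open>\<xi> n i v\<close>, \<open>\<kappa> n i v\<close> be the directional
  derivatives of \<open>x n\<close>, \<open>X n i\<close>, \<open>k n i\<close>; they satisfy the linearised Runge--Kutta equations. The adjoint
  coefficients are exactly those for which
  \<open>lam (n + 1) \<bullet> \<delta> (n + 1) v - lam n \<bullet> \<delta> n v = h \<Sum>i. b i * (Lam n i \<bullet> \<kappa> n i v + l n i \<bullet> \<xi> n i v)\<close>,
  where the terms with \<open>d_x f\<close> cancel and only \<open>Lam n i \<bullet> (d_p f v)\<close> is left. Summation over \<open>n\<close>
  telescopes to the derivative of the cost, because \<open>\<delta> 0 = 0\<close> and \<open>lam N\<close> is the gradient of \<open>C\<close>.\<close>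

section \<open>Contraction in the maximum norm over the stages\<close>

text \<open>A discrete maximum principle: at an index where \<open>e\<close> is largest, a positive
  value would satisfy \<open>e m \<le> \<theta> * e m < e m\<close>. Applied to norms of
  differences, it yields injectivity.\<close>

lemma nonpos_if_row_contraction:
  fixes w :: "'s::finite \<Rightarrow> 's \<Rightarrow> real"
  assumes "\<And>i j. 0 \<le> w i j" and "\<And>i. (\<Sum>j\<in>UNIV. w i j) \<le> \<theta>" and "\<theta> < 1"
    and e: "\<And>i. e i \<le> (\<Sum>j\<in>UNIV. w i j * e j)"
  shows "e i \<le> 0"
proof -
  have "finite (range e)" "range e \<noteq> {}" by auto
  from Max_in[OF this] obtain m where m: "e m = Max (range e)" by (smt (verit) imageE)
  have le: "e j \<le> e m" for j unfolding m by (intro Max_ge) auto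
  have "e m \<le> 0"
  proof (rule ccontr)
    assume "\<not> e m \<le> 0"
    then have pos: "0 < e m" by simp
    have "e m \<le> (\<Sum>j\<in>UNIV. w m j * e m)"
      by (rule order_trans[OF e]) (intro sum_mono mult_left_mono le assms(1))
    also have "\<dots> = (\<Sum>j\<in>UNIV. w m j) * e m" by (simp add: sum_distrib_right)
    also have "\<dots> \<le> \<theta> * e m" using assms(2)[of m] pos by (intro mult_right_mono) auto
    also have "\<dots> < e m" using pos \<open>\<theta> < 1\<close> by simp
    finally show False by simp
  qed
  with le[of i] show ?thesis by linarith
qed

text \<open>The Euclidean norm of the stage vector need not contract, but a high power of \<open>G\<close> does.\<close>

lemma ex1_fixpoint_if_row_contraction:
  fixes G :: "'v::banach^'s \<Rightarrow> 'v^'s" and w :: "'s::finite \<Rightarrow> 's \<Rightarrow> real"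
  assumes w0: "\<And>i j. 0 \<le> w i j" and w: "\<And>i. (\<Sum>j\<in>UNIV. w i j) \<le> \<theta>" and "\<theta> < 1"
    and G: "\<And>Z W i. norm (G Z $ i - G W $ i) \<le> (\<Sum>j\<in>UNIV. w i j * norm (Z $ j - W $ j))"
  shows "\<exists>!Z. G Z = Z"
proof -
  \<comment> \<open>\<open>undefined\<close> is an arbitrary stage; one row of nonnegative weights
    suffices.\<close>
  have \<theta>0: "0 \<le> \<theta>" by (rule order_trans[OF sum_nonneg w[of undefined]]) (simp add: w0)
  have iter: "norm ((G ^^ m) Z $ i - (G ^^ m) W $ i) \<le> \<theta> ^ m * norm (Z - W)" for m Z W i
  proof (induction m arbitrary: i)
    case 0
    then show ?case using Finite_Cartesian_Product.norm_nth_le[of "Z - W" i] by simp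
  next
    case (Suc m)
    have "norm ((G ^^ Suc m) Z $ i - (G ^^ Suc m) W $ i)
        \<le> (\<Sum>j\<in>UNIV. w i j * (\<theta> ^ m * norm (Z - W)))"
      unfolding funpow.simps o_apply
      by (rule order_trans[OF G]) (intro sum_mono mult_left_mono w0 Suc)
    also have "\<dots> = (\<Sum>j\<in>UNIV. w i j) * (\<theta> ^ m * norm (Z - W))"
      by (simp add: sum_distrib_right)
    also have "\<dots> \<le> \<theta> * (\<theta> ^ m * norm (Z - W))"
      using w[of i] \<theta>0 by (intro mult_right_mono) auto
    finally show ?case by (simp add: mult.assoc)
  qed
  have "(\<lambda>m. \<theta> ^ m) \<longlonglongrightarrow> 0" using \<theta>0 \<open>\<theta> < 1\<close> by (intro LIMSEQ_realpow_zero)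
  \<comment> \<open>The factor \<open>CARD('s)\<close> pays for passing from the components to the
    Euclidean norm in \<open>contr\<close>; \<open>m\<close> is chosen to absorb it.\<close>
  then have "(\<lambda>m. real CARD('s) * \<theta> ^ m) \<longlonglongrightarrow> 0" using tendsto_mult_right_zero by blast
  from order_tendstoD(2)[OF this, of 1] obtain m where m: "real CARD('s) * \<theta> ^ m < 1"
    by (auto simp: eventually_sequentially)
  have contr: "dist ((G ^^ m) Z) ((G ^^ m) W) \<le> real CARD('s) * \<theta> ^ m * dist Z W" for Z W
  proof -
    have "dist ((G ^^ m) Z) ((G ^^ m) W) \<le> (\<Sum>i\<in>UNIV. norm (((G ^^ m) Z - (G ^^ m) W) $ i))"
      unfolding dist_norm norm_vec_def by (intro L2_set_le_sum) auto
    also have "\<dots> \<le> (\<Sum>i\<in>(UNIV::'s set). \<theta> ^ m * norm (Z - W))"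
      using iter by (intro sum_mono) simp
    finally show ?thesis by (simp add: dist_norm)
  qed
  have "\<exists>!Z. (G ^^ m) Z = Z"
    using m contr \<theta>0 by (intro banach_fix_type[of "real CARD('s) * \<theta> ^ m"] allI) auto
  then obtain Z where Z: "(G ^^ m) Z = Z" and uniq: "\<And>W. (G ^^ m) W = W \<Longrightarrow> W = Z"
    by blast
  \<comment> \<open>\<open>G\<close> commutes with its powers, so it maps the only fixed point of
    \<open>G ^^ m\<close> to a fixed point of \<open>G ^^ m\<close>, that is, to itself.\<close>
  have "(G ^^ m) (G Z) = G Z" by (metis Z funpow_swap1)
  then have "G Z = Z" by (rule uniq)
  moreover have "W = Z" if "G W = W" for W
  proof (rule uniq)
    show "(G ^^ m) W = W" by (induction m) (simp_all add: that)
  qed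
  ultimately show ?thesis by blast
qed

section \<open>Derivatives, Lipschitz bounds and Jacobians\<close>

text \<open>Difference quotients along the line \<open>x + s *\<^sub>R v\<close> are at most
  \<open>L * norm v\<close>, and the bound survives the limit. In this way the Lipschitz constant
  controls the linearised and the adjoint equations too.\<close>

lemma norm_has_derivative_le_lipschitz:
  fixes f :: "'a::real_normed_vector \<Rightarrow> 'b::real_normed_vector"
  assumes f: "(f has_derivative f') (at x)" and lip: "\<And>y z. norm (f y - f z) \<le> L * norm (y - z)"
  shows "norm (f' v) \<le> L * norm v"
proof -
  interpret bounded_linear f' by (rule has_derivative_bounded_linear[OF f])
  have "((\<lambda>s. x + s *\<^sub>R v) has_derivative (\<lambda>s. s *\<^sub>R v)) (at 0)"
    by (auto intro!: derivative_eq_intros)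
  then have "((f \<circ> (\<lambda>s. x + s *\<^sub>R v)) has_derivative (f' \<circ> (\<lambda>s. s *\<^sub>R v))) (at 0)"
    by (rule diff_chain_at) (simp add: f)
  then have "(\<lambda>s. norm (f (x + s *\<^sub>R v) - f x - s *\<^sub>R f' v) / \<bar>s\<bar>) \<midarrow>0\<rightarrow> 0"
    by (simp add: has_derivative_at o_def scaleR)
  then have "norm (f' v) - L * norm v \<le> 0"
  proof (rule tendsto_lowerbound)
    have "norm (f' v) - L * norm v \<le> norm (f (x + s *\<^sub>R v) - f x - s *\<^sub>R f' v) / \<bar>s\<bar>"
      if "s \<noteq> 0" for s
    proof -
      have "\<bar>s\<bar> * norm (f' v)
          \<le> norm (f (x + s *\<^sub>R v) - f x) + norm (f (x + s *\<^sub>R v) - f x - s *\<^sub>R f' v)"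
        using norm_triangle_sub[of "s *\<^sub>R f' v" "f (x + s *\<^sub>R v) - f x"]
        by (simp add: norm_minus_commute)
      also have "norm (f (x + s *\<^sub>R v) - f x) \<le> L * (\<bar>s\<bar> * norm v)"
        using lip[of "x + s *\<^sub>R v" x] by simp
      finally show ?thesis using that by (simp add: field_simps)
    qed
    then show "\<forall>\<^sub>F s in at 0. norm (f' v) - L * norm v
        \<le> norm (f (x + s *\<^sub>R v) - f x - s *\<^sub>R f' v) / \<bar>s\<bar>"
      by (auto simp: eventually_at_filter)
  qed simp
  then show ?thesis by simp
qed

text \<open>A matrix and its transpose have the same operator norm: bound
  \<open>?z \<bullet> ?z = y \<bullet> (A *v ?z)\<close> by Cauchy-Schwarz and cancel a factor
  \<open>norm ?z\<close>.\<close>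

lemma norm_transpose_mult_le:
  fixes A :: "real^'m^'n"
  assumes "\<And>v. norm (A *v v) \<le> L * norm v"
  shows "norm (transpose A *v y) \<le> L * norm y"
proof -
  let ?z = "transpose A *v y"
  have "norm ?z * norm ?z = ?z \<bullet> ?z" by (simp add: power2_norm_eq_inner[symmetric] power2_eq_square)
  also have "\<dots> = y \<bullet> (A *v ?z)" by (metis dot_lmul_matrix vector_transpose_matrix transpose_transpose inner_commute)
  also have "\<dots> \<le> norm y * norm (A *v ?z)" by (rule norm_cauchy_schwarz)
  also have "\<dots> \<le> norm y * (L * norm ?z)" by (intro mult_left_mono assms) simp
  finally have *: "norm ?z * norm ?z \<le> L * norm y * norm ?z" by (simp add: ac_simps)
  show ?thesis
  proof (cases "?z = 0")
    case True
    \<comment> \<open>Nothing can be cancelled when \<open>?z = 0\<close>; the sign of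
      \<open>L\<close> comes from testing the hypothesis on a unit vector.\<close>
    have "norm (A *v axis undefined 1) \<le> L" using assms[of "axis undefined 1"] by simp
    then have "0 \<le> L" by (rule order_trans[OF norm_ge_zero])
    with True show ?thesis by simp
  next
    case False
    with * show ?thesis by simp
  qed
qed

lemma has_derivative_vec_lambda:
  fixes f :: "'i::finite \<Rightarrow> 'a::real_normed_vector \<Rightarrow> 'b::euclidean_space"
  assumes "\<And>i. (f i has_derivative f' i) (at x within S)"
  shows "((\<lambda>x. \<chi> i. f i x) has_derivative (\<lambda>v. \<chi> i. f' i v)) (at x within S)"
  unfolding has_derivative_componentwise_within[of "\<lambda>x. \<chi> i. f i x"]
  by (auto simp: Basis_vec_def inner_axis intro!: has_derivative_inner_left assms)

text \<open>The stages move with \<open>p\<close>, so the chain rule needs a total derivative, while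
  the setting supplies partial ones. Continuity of the Jacobian in \<open>p\<close> makes the linear
  approximation in \<open>p\<close> uniform near \<open>(x, p)\<close>.\<close>

lemma has_derivative_jacobian_partials:
  fixes f :: "real^'n \<Rightarrow> real^'p \<Rightarrow> real^'m"
  assumes dx: "\<And>x p. (\<lambda>y. f y p) differentiable (at x)"
    and dp: "\<And>x p. (\<lambda>q. f x q) differentiable (at p)"
    and cont: "continuous_on UNIV (\<lambda>(x, p). jacobian (\<lambda>q. f x q) (at p))"
  shows "((\<lambda>z. f (fst z) (snd z)) has_derivative
    (\<lambda>v. jacobian (\<lambda>y. f y p) (at x) *v fst v + jacobian (\<lambda>q. f x q) (at p) *v snd v)) (at (x, p))"
proof -
  let ?J = "\<lambda>x p. jacobian (\<lambda>q. f x q) (at p)"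
  have bl: "bounded_linear ((*v) A)" for A :: "real^'p^'m"
    by (rule matrix_vector_mul_bounded_linear)
  have "isCont (\<lambda>z. ?J (fst z) (snd z)) (x, p)"
    using cont by (simp add: continuous_on_eq_continuous_at case_prod_unfold)
  then have c: "((\<lambda>z. ?J (fst z) (snd z)) \<longlongrightarrow> ?J x p) (at (x, p))"
    by (simp add: isCont_def)
  \<comment> \<open>The criterion wants the partial derivative to converge in operator norm; in
    finite dimension convergence on each vector is enough.\<close>
  have "((\<lambda>z. Blinfun ((*v) (?J (fst z) (snd z)))) \<longlongrightarrow> Blinfun ((*v) (?J x p))) (at (x, p))"
  proof (rule tendsto_componentwise1)
    fix e :: "real^'p"
    have "((\<lambda>z. ?J (fst z) (snd z) *v e) \<longlongrightarrow> ?J x p *v e) (at (x, p))"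
      by (intro bounded_linear.tendsto[OF _ c] 
          linear_conv_bounded_linear[THEN iffD1] linearI)
         (simp_all add: matrix_vector_mult_add_rdistrib scaleR_matrix_vector_assoc)
    then show "((\<lambda>z. blinfun_apply (Blinfun ((*v) (?J (fst z) (snd z)))) e) \<longlongrightarrow>
      blinfun_apply (Blinfun ((*v) (?J x p))) e) (at (x, p))"
      by (simp add: bounded_linear_Blinfun_apply[OF bl])
  qed
  then have "((\<lambda>(x, p). f x p) has_derivative (\<lambda>(v, w). jacobian (\<lambda>y. f y p) (at x) *v v
      + blinfun_apply (Blinfun ((*v) (?J x p))) w)) (at (x, p) within UNIV \<times> UNIV)"
    using dx dp
    by (intro has_derivative_partialsI)
       (auto simp: bounded_linear_Blinfun_apply[OF bl] jacobian_works isCont_def case_prod_unfold)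
  then show ?thesis
    by (simp add: bounded_linear_Blinfun_apply[OF bl] case_prod_unfold)
qed

section \<open>Differentiable dependence of the implicit stages on the parameter\<close>

text \<open>Solving the stage equations inverts \<open>F(Z, q) = (Z - h a g(Z, q), q)\<close>, so
  differentiability comes from the inverse function theorem. The contraction makes both
  \<open>F\<close> and its derivative injective.\<close>

lemma stages_differentiable:
  fixes g :: "'s::finite \<Rightarrow> 'v::euclidean_space \<Rightarrow> 'q::euclidean_space \<Rightarrow> 'v"
    and a :: "'s \<Rightarrow> 's \<Rightarrow> real" and u :: "'q \<Rightarrow> 'v" and Z :: "'q \<Rightarrow> 's \<Rightarrow> 'v"
  assumes diff: "\<And>j z. (\<lambda>y. g j (fst y) (snd y)) differentiable (at z)"
    and lip: "\<And>j z z' q. norm (g j z q - g j z' q) \<le> L * norm (z - z')"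
    and "0 \<le> h" "0 \<le> L" and small: "\<And>i. (\<Sum>j\<in>UNIV. h * L * \<bar>a i j\<bar>) \<le> \<theta>" and "\<theta> < 1"
    and u: "u differentiable (at p)"
    and Z: "\<And>q i. Z q i = u q + h *\<^sub>R (\<Sum>j\<in>UNIV. a i j *\<^sub>R g j (Z q j) q)"
  shows "(\<lambda>q. Z q i) differentiable (at p)"
proof -
  define F :: "('v^'s) \<times> 'q \<Rightarrow> ('v^'s) \<times> 'q" where
    "F y = (\<chi> i. fst y $ i - h *\<^sub>R (\<Sum>j\<in>UNIV. a i j *\<^sub>R g j (fst y $ j) (snd y)), snd y)" for y
  define z :: "('v^'s) \<times> 'q" where "z = (\<chi> i. Z p i, p)"
  \<comment> \<open>The maximum principle with the weights \<open>h * L * \<bar>a i j\<bar>\<close>;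
    \<open>e\<close> will be the stage norms of a difference, then those of a kernel vector.\<close>
  have zero: "e i = 0" if "\<And>i. 0 \<le> e i"
    and "\<And>i. e i \<le> (\<Sum>j\<in>UNIV. (h * L * \<bar>a i j\<bar>) * e j)" for e :: "'s \<Rightarrow> real" and i
    using nonpos_if_row_contraction[of "\<lambda>i j. h * L * \<bar>a i j\<bar>" \<theta> e i, OF _ small \<open>\<theta> < 1\<close> that(2)]
      that(1)[of i] \<open>0 \<le> h\<close> \<open>0 \<le> L\<close> by simp
  have sum_bound: "norm (h *\<^sub>R (\<Sum>j\<in>UNIV. a i j *\<^sub>R v j)) \<le> (\<Sum>j\<in>UNIV. (h * L * \<bar>a i j\<bar>) * e j)"
    if "\<And>j. norm (v j) \<le> L * e j" for v :: "'s \<Rightarrow> 'v" and e i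
  proof -
    have "norm (h *\<^sub>R (\<Sum>j\<in>UNIV. a i j *\<^sub>R v j)) \<le> h * (\<Sum>j\<in>UNIV. \<bar>a i j\<bar> * (L * e j))"
      unfolding norm_scaleR abs_of_nonneg[OF \<open>0 \<le> h\<close>]
      by (intro mult_left_mono sum_norm_le \<open>0 \<le> h\<close>) (simp add: mult_left_mono that)
    then show ?thesis by (simp add: sum_distrib_left ac_simps)
  qed
  have "inj F"
  proof (rule injI)
    fix y y' assume eq: "F y = F y'"
    then have s: "snd y = snd y'" by (simp add: F_def)
    have d: "fst y $ i - fst y' $ i =
        h *\<^sub>R (\<Sum>j\<in>UNIV. a i j *\<^sub>R (g j (fst y $ j) (snd y) - g j (fst y' $ j) (snd y)))" for i
      using arg_cong[OF eq, of "\<lambda>v. fst v $ i"]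
      by (simp only: F_def s fst_conv vec_lambda_beta scaleR_diff_right sum_subtractf) (simp add: algebra_simps)
    have "norm (fst y $ i - fst y' $ i) = 0" for i
      by (rule zero[of "\<lambda>i. norm (fst y $ i - fst y' $ i)"])
         (simp, subst (1) d, rule sum_bound, rule lip)
    with s show "y = y'" by (simp add: prod_eq_iff vec_eq_iff)
  qed
  have "\<exists>g'. \<forall>j z. ((\<lambda>y. g j (fst y) (snd y)) has_derivative g' j z) (at z)"
    using diff unfolding differentiable_def by metis
  then obtain g' where g': "\<And>j z. ((\<lambda>y. g j (fst y) (snd y)) has_derivative g' j z) (at z)"
    by blast
  define F' :: "('v^'s) \<times> 'q \<Rightarrow> ('v^'s) \<times> 'q \<Rightarrow> ('v^'s) \<times> 'q" where
    "F' y v = (\<chi> i. fst v $ i - h *\<^sub>R (\<Sum>j\<in>UNIV. a i j *\<^sub>R g' j (fst y $ j, snd y) (fst v $ j, snd v)), snd v)"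
    for y v
  have gy: "((\<lambda>y. g j (fst y $ j) (snd y)) has_derivative
      (\<lambda>v. g' j (fst y $ j, snd y) (fst v $ j, snd v))) (at y)" for j and y :: "('v^'s) \<times> 'q"
  proof -
    have "((\<lambda>y. (fst y $ j, snd y)) has_derivative (\<lambda>v. (fst v $ j, snd v))) (at y)"
      by (intro has_derivative_Pair bounded_linear.has_derivative[OF bounded_linear_vec_nth] derivative_intros)
    from diff_chain_at[OF this g'] show ?thesis by (simp add: o_def)
  qed
  have F': "(F has_derivative F' y) (at y)" for y
    unfolding F_def[abs_def] F'_def
    by (intro has_derivative_Pair has_derivative_vec_lambda has_derivative_diff
        has_derivative_scaleR_right has_derivative_sum gy
        bounded_linear.has_derivative[OF bounded_linear_vec_nth] derivative_intros)
  \<comment> \<open>Kernel vectors of \<open>F' z\<close> have parameter component 0, so only the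
    directions \<open>(v, 0)\<close> need a bound.\<close>
  have bound': "norm (g' j (x, q) (v, 0)) \<le> L * norm v" for j x q v
  proof -
    have "((\<lambda>x. (x, q)) has_derivative (\<lambda>v. (v, 0))) (at x)" by (auto intro!: derivative_intros)
    from diff_chain_at[OF this g'] have "((\<lambda>x. g j x q) has_derivative (\<lambda>v. g' j (x, q) (v, 0))) (at x)"
      by (simp add: o_def)
    then show ?thesis by (rule norm_has_derivative_le_lipschitz) (rule lip)
  qed
  interpret F': bounded_linear "F' z" by (rule has_derivative_bounded_linear[OF F'])
  have "inj (F' z)"
    unfolding linear_injective_0[OF F'.linear]
  proof (intro allI impI)
    fix v assume eq: "F' z v = 0"
    then have s: "snd v = 0" by (simp add: F'_def zero_prod_def)
    have d: "fst v $ i = h *\<^sub>R (\<Sum>j\<in>UNIV. a i j *\<^sub>R g' j (fst z $ j, snd z) (fst v $ j, 0))" for i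
      using arg_cong[OF eq, of "\<lambda>v. fst v $ i"]
      by (simp only: F'_def s fst_conv fst_zero vec_lambda_beta zero_index right_minus_eq)
    have "norm (fst v $ i) = 0" for i
      by (rule zero[of "\<lambda>i. norm (fst v $ i)"]) (simp, subst (1) d, rule sum_bound, rule bound')
    with s show "v = 0" by (simp add: prod_eq_iff vec_eq_iff)
  qed
  then obtain S where S: "linear S" "\<And>x. F' z (S x) = x"
    using linear_injective_isomorphism[OF F'.linear] by blast
  have "(inv F has_derivative S) (at (F z))"
  proof (rule has_derivative_inverse_strong[where f = F and S = UNIV and f' = "F' z"])
    show "continuous_on UNIV F"
      by (intro continuous_at_imp_continuous_on ballI has_derivative_continuous[OF F'])
  qed (use F' S \<open>inj F\<close> in auto)
  \<comment> \<open>The stages at \<open>q\<close> are the preimage of \<open>(u q, q)\<close>, so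
    they depend on \<open>q\<close> through \<open>inv F\<close> after a differentiable map.\<close>
  moreover have Fz: "F (\<chi> i. Z q i, q) = (\<chi> i. u q, q)" for q
  proof -
    have "Z q i - h *\<^sub>R (\<Sum>j\<in>UNIV. a i j *\<^sub>R g j (Z q j) q) = u q" for i
      by (subst Z) simp
    then show ?thesis by (simp add: F_def vec_eq_iff)
  qed
  ultimately have invF: "inv F differentiable at (\<chi> i. u p, p)"
    unfolding z_def differentiable_def by auto
  obtain u' where u': "(u has_derivative u') (at p)" using u by (auto simp: differentiable_def)
  have "((\<lambda>q. (\<chi> i::'s. u q, q)) has_derivative (\<lambda>v. (\<chi> i. u' v, v))) (at p)"
    by (intro has_derivative_Pair has_derivative_vec_lambda u' derivative_intros)
  then have "(\<lambda>q. (\<chi> i::'s. u q, q)) differentiable (at p)"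
    by (auto simp: differentiable_def)
  from differentiable_chain_at[OF this invF]
  have "(\<lambda>q. (\<chi> i. Z q i, q)) differentiable (at p)"
    by (simp add: o_def Fz[symmetric] inv_f_f[OF \<open>inj F\<close>])
  then obtain D where "((\<lambda>q. (\<chi> i. Z q i, q)) has_derivative D) (at p)"
    by (auto simp: differentiable_def)
  then have "((\<lambda>q. fst (\<chi> i. Z q i, q) $ i) has_derivative (\<lambda>v. fst (D v) $ i)) (at p)"
    by (intro bounded_linear.has_derivative[OF bounded_linear_vec_nth] has_derivative_fst)
  then show ?thesis by (auto simp: differentiable_def)
qed

section \<open>One step of the adjoint scheme: duality and solvability\<close>

text \<open>The choice of \<open>abar\<close> makes the method symplectic: all mixed terms \<open>l j \<bullet> \<kappa> i\<close> cancel.\<close>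

lemma adjoint_step_duality:
  fixes l Lam \<kappa> \<xi> :: "'s::finite \<Rightarrow> 'v::real_inner" and a abar :: "'s \<Rightarrow> 's \<Rightarrow> real"
  assumes b: "\<And>i. b i \<noteq> 0" and abar: "\<And>i j. abar i j = b j - a j i * b j / b i"
    and \<delta>': "\<delta>' = \<delta> + h *\<^sub>R (\<Sum>i\<in>UNIV. b i *\<^sub>R \<kappa> i)"
    and \<xi>: "\<And>i. \<xi> i = \<delta> + h *\<^sub>R (\<Sum>j\<in>UNIV. a i j *\<^sub>R \<kappa> j)"
    and lam': "lam' = lam + h *\<^sub>R (\<Sum>i\<in>UNIV. b i *\<^sub>R l i)"
    and Lam: "\<And>i. Lam i = lam + h *\<^sub>R (\<Sum>j\<in>UNIV. abar i j *\<^sub>R l j)"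
  shows "lam' \<bullet> \<delta>' - lam \<bullet> \<delta> = h * (\<Sum>i\<in>UNIV. b i * (Lam i \<bullet> \<kappa> i + l i \<bullet> \<xi> i))"
proof -
  \<comment> \<open>Rearranged, this is the symplecticity relation
    \<open>b i * abar i j + b j * a j i = b i * b j\<close>.\<close>
  have ab: "b i * abar i j = b i * b j - a j i * b j" for i j
    using b[of i] by (simp add: abar field_simps)
  have "(\<Sum>i\<in>UNIV. b i * (Lam i \<bullet> \<kappa> i)) = (\<Sum>i\<in>UNIV. b i * (lam \<bullet> \<kappa> i))
      + h * (\<Sum>i\<in>UNIV. \<Sum>j\<in>UNIV. (b i * abar i j) * (l j \<bullet> \<kappa> i))"
    by (simp add: Lam inner_add_left inner_sum_left distrib_left sum.distrib sum_distrib_left ac_simps)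
  also have "(\<Sum>i\<in>UNIV. \<Sum>j\<in>UNIV. (b i * abar i j) * (l j \<bullet> \<kappa> i))
      = (\<Sum>i\<in>UNIV. \<Sum>j\<in>UNIV. (b i * b j) * (l j \<bullet> \<kappa> i)) - (\<Sum>i\<in>UNIV. \<Sum>j\<in>UNIV. (a j i * b j) * (l j \<bullet> \<kappa> i))"
    by (simp add: ab left_diff_distrib sum_subtractf)
  \<comment> \<open>Interchanging the indices gives this term the form in which it reappears, with
    the opposite sign, in \<open>2\<close>.\<close>
  also have "(\<Sum>i\<in>UNIV. \<Sum>j\<in>UNIV. (a j i * b j) * (l j \<bullet> \<kappa> i))
      = (\<Sum>i\<in>UNIV. \<Sum>j\<in>UNIV. (a i j * b i) * (l i \<bullet> \<kappa> j))"
    by (rule sum.swap)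
  finally have 1: "(\<Sum>i\<in>UNIV. b i * (Lam i \<bullet> \<kappa> i)) = (\<Sum>i\<in>UNIV. b i * (lam \<bullet> \<kappa> i))
      + h * ((\<Sum>i\<in>UNIV. \<Sum>j\<in>UNIV. (b i * b j) * (l j \<bullet> \<kappa> i))
      - (\<Sum>i\<in>UNIV. \<Sum>j\<in>UNIV. (a i j * b i) * (l i \<bullet> \<kappa> j)))" .
  have 2: "(\<Sum>i\<in>UNIV. b i * (l i \<bullet> \<xi> i)) = (\<Sum>i\<in>UNIV. b i * (l i \<bullet> \<delta>))
      + h * (\<Sum>i\<in>UNIV. \<Sum>j\<in>UNIV. (a i j * b i) * (l i \<bullet> \<kappa> j))"
    by (simp add: \<xi> inner_add_right inner_sum_right distrib_left sum.distrib sum_distrib_left ac_simps)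
  have 3: "lam' \<bullet> \<delta>' - lam \<bullet> \<delta> = h * (\<Sum>i\<in>UNIV. b i * (lam \<bullet> \<kappa> i)) + h * (\<Sum>i\<in>UNIV. b i * (l i \<bullet> \<delta>))
      + h * (h * (\<Sum>i\<in>UNIV. \<Sum>j\<in>UNIV. (b i * b j) * (l j \<bullet> \<kappa> i)))"
    by (simp add: \<delta>' lam' inner_add_left inner_add_right inner_sum_left inner_sum_right distrib_left
        sum.distrib sum_distrib_left ac_simps)
  show ?thesis unfolding 3 distrib_left sum.distrib 1 2 by (simp add: algebra_simps)
qed

text \<open>Multiplying by \<open>b i\<close> turns the adjoint stage equations, solved backwards from \<open>lam'\<close>, into a
  system for \<open>b i *\<^sub>R Lam i\<close> with the transposed coefficients \<open>a j i\<close>, whose column sums contract.\<close>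

lemma adjoint_step_solvable:
  fixes B :: "'s::finite \<Rightarrow> 'v::euclidean_space \<Rightarrow> 'v" and a abar :: "'s \<Rightarrow> 's \<Rightarrow> real"
  assumes b: "\<And>i. b i \<noteq> 0" and abar: "\<And>i j. abar i j = b j - a j i * b j / b i"
    and lin: "\<And>i. linear (B i)" and B: "\<And>i v. norm (B i v) \<le> L * norm v"
    and "0 \<le> h" "0 \<le> L" and small: "\<And>i. (\<Sum>j\<in>UNIV. h * L * \<bar>a i j\<bar>) \<le> \<theta>" and "\<theta> < 1"
  shows "\<exists>lam l Lam. lam' = lam + h *\<^sub>R (\<Sum>i\<in>UNIV. b i *\<^sub>R l i) \<and> (\<forall>i. l i = - B i (Lam i)) \<and>
    (\<forall>i. Lam i = lam + h *\<^sub>R (\<Sum>j\<in>UNIV. abar i j *\<^sub>R l j))"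
proof -
  define M :: "'v^'s \<Rightarrow> 'v^'s" where
    "M \<mu> = (\<chi> i. \<mu> $ i - h *\<^sub>R (\<Sum>j\<in>UNIV. a j i *\<^sub>R B j (\<mu> $ j)))" for \<mu>
  have linM: "linear M"
  proof (rule linearI)
    show "M (x + y) = M x + M y" for x y
      by (simp add: M_def vec_eq_iff linear_add[OF lin] scaleR_add_right sum.distrib)
    show "M (r *\<^sub>R x) = r *\<^sub>R M x" for r x
      by (simp add: M_def vec_eq_iff linear_scale[OF lin] scaleR_diff_right scaleR_sum_right
          mult.commute mult.left_commute)
  qed
  have "inj M"
    unfolding linear_injective_0[OF linM]
  proof (intro allI impI)
    fix \<mu> assume "M \<mu> = 0"
    have \<mu>: "\<mu> $ i = h *\<^sub>R (\<Sum>j\<in>UNIV. a j i *\<^sub>R B j (\<mu> $ j))" for i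
      using arg_cong[OF \<open>M \<mu> = 0\<close>, of "\<lambda>v. v $ i"]
      by (simp only: M_def vec_lambda_beta zero_index right_minus_eq)
    \<comment> \<open>With transposed coefficients the sum norm replaces the maximum norm:
      exchanging the summations brings back the row sums of \<open>a\<close>.\<close>
    let ?S = "\<Sum>i\<in>UNIV. norm (\<mu> $ i)"
    have "norm (\<mu> $ i) \<le> (\<Sum>j\<in>UNIV. h * L * \<bar>a j i\<bar> * norm (\<mu> $ j))" for i
    proof -
      have "norm (\<mu> $ i) \<le> h * (\<Sum>j\<in>UNIV. \<bar>a j i\<bar> * (L * norm (\<mu> $ j)))"
        by (subst \<mu>, unfold norm_scaleR abs_of_nonneg[OF \<open>0 \<le> h\<close>])
           (intro mult_left_mono sum_norm_le \<open>0 \<le> h\<close>, simp add: mult_left_mono B)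
      then show ?thesis by (simp add: sum_distrib_left ac_simps)
    qed
    then have "?S \<le> (\<Sum>i\<in>UNIV. \<Sum>j\<in>UNIV. h * L * \<bar>a j i\<bar> * norm (\<mu> $ j))"
      by (intro sum_mono)
    also have "\<dots> = (\<Sum>j\<in>UNIV. (\<Sum>i\<in>UNIV. h * L * \<bar>a j i\<bar>) * norm (\<mu> $ j))"
      by (subst sum.swap) (simp add: sum_distrib_right)
    also have "\<dots> \<le> (\<Sum>j\<in>UNIV. \<theta> * norm (\<mu> $ j))"
      by (intro sum_mono mult_right_mono small) simp
    finally have "?S \<le> \<theta> * ?S" by (simp add: sum_distrib_left)
    moreover have "0 \<le> ?S" by (simp add: sum_nonneg)
    ultimately have "?S = 0"
      using \<open>\<theta> < 1\<close> by (smt (verit) mult_less_cancel_right2)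
    then show "\<mu> = 0" by (simp add: sum_nonneg_eq_0_iff vec_eq_iff)
  qed
  then obtain S where "\<And>x. M (S x) = x"
    using linear_injective_isomorphism[OF linM] by blast
  then obtain \<mu> where M\<mu>: "M \<mu> = (\<chi> i. b i *\<^sub>R lam')" by blast
  have \<mu>: "\<mu> $ i = b i *\<^sub>R lam' + h *\<^sub>R (\<Sum>j\<in>UNIV. a j i *\<^sub>R B j (\<mu> $ j))" for i
    using arg_cong[OF M\<mu>, of "\<lambda>v. v $ i"] by (simp only: M_def vec_lambda_beta diff_eq_eq)
  \<comment> \<open>Undoing the scaling by \<open>b i\<close> gives the stages; \<open>lam\<close>
    is then defined so that the update ends in the prescribed \<open>lam'\<close>.\<close>
  define Lam where "Lam i = \<mu> $ i /\<^sub>R b i" for i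
  define l where "l i = - B i (Lam i)" for i
  define lam where "lam = lam' - h *\<^sub>R (\<Sum>i\<in>UNIV. b i *\<^sub>R l i)"
  have bl: "B j (\<mu> $ j) = - (b j *\<^sub>R l j)" for j
    using b[of j] by (simp add: l_def Lam_def linear_scale[OF lin])
  have "Lam i = lam + h *\<^sub>R (\<Sum>j\<in>UNIV. abar i j *\<^sub>R l j)" for i
  proof -
    \<comment> \<open>The stage equation seen from \<open>lam'\<close>; expressing
      \<open>lam'\<close> through \<open>lam\<close> adds \<open>b j\<close> to each coefficient and
      produces \<open>abar i j\<close>.\<close>
    have "Lam i = lam' - h *\<^sub>R (\<Sum>j\<in>UNIV. (a j i * b j / b i) *\<^sub>R l j)"
      using b[of i] by (subst Lam_def, subst \<mu>) (simp add: bl scaleR_add_right scaleR_diff_right sum_negf scaleR_sum_right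
          divide_inverse ac_simps)
    then show ?thesis
      by (simp add: lam_def abar scaleR_diff_left sum_subtractf scaleR_diff_right)
  qed
  moreover have "lam' = lam + h *\<^sub>R (\<Sum>i\<in>UNIV. b i *\<^sub>R l i)" by (simp add: lam_def)
  ultimately show ?thesis using l_def by blast
qed

section \<open>The forward scheme: solvability and uniqueness\<close>

text \<open>The hypotheses as they act at the evaluation times: \<open>\<theta> n\<close> is a
  contraction factor for step \<open>n\<close>, and the step-size condition appears without
  division, which covers vanishing \<open>a\<close> or \<open>L\<close>.\<close>

locale contractive_rk =
  fixes a :: "'s::finite \<Rightarrow> 's \<Rightarrow> real" and b c :: "'s \<Rightarrow> real" and t :: "nat \<Rightarrow> real" and N :: nat
    and f :: "real^'nx \<Rightarrow> real^'np \<Rightarrow> real \<Rightarrow> real^'nx" and x0 :: "real^'nx"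
    and L :: real and \<theta> :: "nat \<Rightarrow> real"
  assumes L: "0 \<le> L"
    and step: "\<And>n. n < N \<Longrightarrow> 0 \<le> step t n"
    and small: "\<And>n i. n < N \<Longrightarrow> (\<Sum>j\<in>UNIV. step t n * L * \<bar>a i j\<bar>) \<le> \<theta> n"
    and \<theta>: "\<And>n. n < N \<Longrightarrow> \<theta> n < 1"
    and lip: "\<And>n i x y p. n < N \<Longrightarrow>
      norm (f x p (t n + c i * step t n) - f y p (t n + c i * step t n)) \<le> L * norm (x - y)"
    and deriv: "\<And>n i x p. n < N \<Longrightarrow> ((\<lambda>z. f (fst z) (snd z) (t n + c i * step t n)) has_derivative
      (\<lambda>v. d_x f x p (t n + c i * step t n) *v fst v + d_p f x p (t n + c i * step t n) *v snd v)) (at (x, p))"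
begin

text \<open>The base value \<open>u\<close> is arbitrary, so that the fixed point argument serves
  both for building a solution and for comparing two.\<close>

lemma stages_ex1:
  assumes n: "n < N"
  shows "\<exists>!Z. \<forall>i. Z i = u + step t n *\<^sub>R (\<Sum>j\<in>UNIV. a i j *\<^sub>R f (Z j) p (t n + c j * step t n))"
proof -
  \<comment> \<open>The stages are packed into one vector, where the contraction argument applies,
    and unpacked with \<open>$\<close>.\<close>
  define G :: "(real^'nx)^'s \<Rightarrow> (real^'nx)^'s" where
    "G Z = (\<chi> i. u + step t n *\<^sub>R (\<Sum>j\<in>UNIV. a i j *\<^sub>R f (Z $ j) p (t n + c j * step t n)))" for Z
  have "\<exists>!Z. G Z = Z"
  proof (rule ex1_fixpoint_if_row_contraction[OF _ small[OF n] \<theta>[OF n]])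
    show "0 \<le> step t n * L * \<bar>a i j\<bar>" for i j using step[OF n] L by simp
    show "norm (G Z $ i - G W $ i) \<le> (\<Sum>j\<in>UNIV. step t n * L * \<bar>a i j\<bar> * norm (Z $ j - W $ j))" for Z W i
    proof -
      have "G Z $ i - G W $ i = step t n *\<^sub>R (\<Sum>j\<in>UNIV. a i j *\<^sub>R
          (f (Z $ j) p (t n + c j * step t n) - f (W $ j) p (t n + c j * step t n)))"
        by (simp add: G_def scaleR_diff_right sum_subtractf)
      also have "norm \<dots> \<le> step t n * (\<Sum>j\<in>UNIV. \<bar>a i j\<bar> * (L * norm (Z $ j - W $ j)))"
        unfolding norm_scaleR abs_of_nonneg[OF step[OF n]]
        by (intro mult_left_mono sum_norm_le step n) (simp add: mult_left_mono lip[OF n])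
      finally show ?thesis by (simp add: sum_distrib_left ac_simps)
    qed
  qed
  then obtain Z where Z: "G Z = Z" and uniq: "\<And>W. G W = W \<Longrightarrow> W = Z" by blast
  show ?thesis
  proof (rule ex1I)
    show "\<forall>i. Z $ i = u + step t n *\<^sub>R (\<Sum>j\<in>UNIV. a i j *\<^sub>R f (Z $ j) p (t n + c j * step t n))"
      using arg_cong[OF Z, of "\<lambda>v. v $ i" for i] by (simp only: G_def vec_lambda_beta) metis
    fix W assume W: "\<forall>i. W i = u + step t n *\<^sub>R (\<Sum>j\<in>UNIV. a i j *\<^sub>R f (W j) p (t n + c j * step t n))"
    have "G (\<chi> i. W i) = (\<chi> i. W i)"
      unfolding G_def vec_lambda_beta by (subst W[rule_format, symmetric]) (rule refl)
    from uniq[OF this] show "W = ($) Z" by auto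
  qed
qed

lemma forward_rk_exists: "\<exists>x k X. forward_rk a b c t N f x0 p x k X"
proof -
  \<comment> \<open>Stages are chosen as a function of the base value, so that the iterates follow
    by recursion. For \<open>n \<ge> N\<close> the choice may be arbitrary; the scheme constrains
    only \<open>n < N\<close>.\<close>
  define X where "X n u = (SOME Z. \<forall>i. Z i = u + step t n *\<^sub>R (\<Sum>j\<in>UNIV. a i j *\<^sub>R f (Z j) p (t n + c j * step t n)))"
    for n u
  have X: "X n u i = u + step t n *\<^sub>R (\<Sum>j\<in>UNIV. a i j *\<^sub>R f (X n u j) p (t n + c j * step t n))"
    if "n < N" for n u i
    using someI_ex[OF ex1_implies_ex[OF stages_ex1[OF that]], of u p] unfolding X_def[symmetric] by blast
  define k where "k n u i = f (X n u i) p (t n + c i * step t n)" for n u i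
  define x where "x = rec_nat x0 (\<lambda>n u. u + step t n *\<^sub>R (\<Sum>i\<in>UNIV. b i *\<^sub>R k n u i))"
  have "forward_rk a b c t N f x0 p x (\<lambda>n. k n (x n)) (\<lambda>n. X n (x n))"
    unfolding forward_rk_def rk_scheme_def
  proof (intro conjI allI impI)
    fix n i assume "n < N"
    then show "X n (x n) i = x n + step t n *\<^sub>R (\<Sum>j\<in>UNIV. a i j *\<^sub>R k n (x n) j)"
      unfolding k_def by (rule X)
  qed (simp_all add: x_def k_def)
  then show ?thesis by blast
qed

lemma forward_rkD:
  assumes "forward_rk a b c t N f x0 p x k X" and "n < N"
  shows "x (Suc n) = x n + step t n *\<^sub>R (\<Sum>i\<in>UNIV. b i *\<^sub>R k n i)"
    and "k n i = f (X n i) p (t n + c i * step t n)"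
    and "X n i = x n + step t n *\<^sub>R (\<Sum>j\<in>UNIV. a i j *\<^sub>R k n j)"
  using assms unfolding forward_rk_def rk_scheme_def by blast+

lemma forward_rk_stages:
  assumes "forward_rk a b c t N f x0 p x k X" and "n < N"
  shows "X n i = x n + step t n *\<^sub>R (\<Sum>j\<in>UNIV. a i j *\<^sub>R f (X n j) p (t n + c j * step t n))"
  by (simp only: forward_rkD(3)[OF assms, of i] forward_rkD(2)[OF assms])

text \<open>Induction over the steps: equal iterates have equal stages, and these determine the next
  iterate. Beyond \<open>N\<close> the scheme leaves the sequences free.\<close>

lemma forward_rk_unique:
  assumes 1: "forward_rk a b c t N f x0 p x k X" and 2: "forward_rk a b c t N f x0 p x' k' X'"
  shows "n \<le> N \<Longrightarrow> x n = x' n" and "n < N \<Longrightarrow> X n = X' n"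
proof -
  have X: "X n = X' n" if n: "n < N" and eq: "x n = x' n" for n
  proof (rule Uniq_D)
    let ?P = "\<lambda>Z. \<forall>i. Z i = x n + step t n *\<^sub>R (\<Sum>j\<in>UNIV. a i j *\<^sub>R f (Z j) p (t n + c j * step t n))"
    show "\<exists>\<^sub>\<le>\<^sub>1Z. ?P Z" using stages_ex1[OF n, of "x n" p] by (simp only: ex1_iff_ex_Uniq)
    show "?P (X n)" by (intro allI forward_rk_stages[OF 1 n])
    show "?P (X' n)" unfolding eq by (intro allI forward_rk_stages[OF 2 n])
  qed
  have x: "x n = x' n" if "n \<le> N" for n
    using that
  proof (induction n)
    case 0
    then show ?case using 1 2 by (simp add: forward_rk_def)
  next
    case (Suc n)
    then have n: "n < N" "x n = x' n" by simp_all
    show ?case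
      using X[OF n] n(2) forward_rkD(1,2)[OF 1 n(1)] forward_rkD(1,2)[OF 2 n(1)] by simp
  qed
  show "n \<le> N \<Longrightarrow> x n = x' n" by (rule x)
  show "n < N \<Longrightarrow> X n = X' n" using X x by simp
qed

lemma rk_final_eq:
  assumes "forward_rk a b c t N f x0 p x k X"
  shows "rk_final a b c t N f x0 p = x N"
  unfolding rk_final_def
proof (rule the_equality)
  show "\<exists>x' k' X'. forward_rk a b c t N f x0 p x' k' X' \<and> x N = x' N"
    by (intro exI conjI, rule assms, rule refl)
  show "z = x N" if "\<exists>x' k' X'. forward_rk a b c t N f x0 p x' k' X' \<and> z = x' N" for z
  proof -
    from that obtain x' k' X' where "forward_rk a b c t N f x0 p x' k' X'" "z = x' N" by blast
    then show ?thesis using forward_rk_unique(1)[OF assms, of x' k' X' N] by simp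
  qed
qed

section \<open>Existence of the discrete adjoint variables\<close>

text \<open>Restricting the total derivative to directions \<open>(v, 0)\<close> isolates
  \<open>d_x f\<close>, which inherits the Lipschitz bound; the contraction thus also covers the
  adjoint steps.\<close>

lemma norm_d_x_mult_le:
  assumes n: "n < N"
  shows "norm (d_x f x p (t n + c i * step t n) *v v) \<le> L * norm v"
proof -
  have "((\<lambda>x. (x, p)) has_derivative (\<lambda>v. (v, 0))) (at x)"
    by (intro has_derivative_Pair has_derivative_ident has_derivative_const)
  from diff_chain_at[OF this deriv[OF n]]
  have "((\<lambda>x. f x p (t n + c i * step t n)) has_derivative (\<lambda>v. d_x f x p (t n + c i * step t n) *v v)) (at x)"
    by (simp add: o_def)
  then show ?thesis by (rule norm_has_derivative_le_lipschitz) (rule lip[OF n])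
qed

text \<open>The steps are solved backwards from the terminal gradient, each by
  \<open>adjoint_step_solvable\<close>; the transposed Jacobians obey the same bound
  \<open>L\<close>.\<close>

lemma adjoint_rk_exists:
  assumes b: "\<And>i. b i \<noteq> 0" and abar: "\<And>i j. abar i j = b j - a j i * b j / b i"
    and grad: "GDERIV C z :> g"
  shows "\<exists>lam l Lam. adjoint_rk abar b c t N f C p z X lam l Lam"
proof -
  let ?B = "\<lambda>n i v. transpose (d_x f (X n i) p (t n + c i * step t n)) *v v"
  define R where "R n lam' lam l Lam \<longleftrightarrow> lam' = lam + step t n *\<^sub>R (\<Sum>i\<in>UNIV. b i *\<^sub>R l i) \<and>
    (\<forall>i. l i = - ?B n i (Lam i)) \<and> (\<forall>i. Lam i = lam + step t n *\<^sub>R (\<Sum>j\<in>UNIV. abar i j *\<^sub>R l j))"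
    for n lam' lam l Lam
  have "\<exists>lam l Lam. R n lam' lam l Lam" if n: "n < N" for n lam'
    unfolding R_def
    by (rule adjoint_step_solvable[where B = "?B n", OF b abar matrix_vector_mul_linear
          norm_transpose_mult_le[OF norm_d_x_mult_le[OF n]] step[OF n] L small[OF n] \<theta>[OF n]])
  then obtain P l Lam where R: "\<And>n lam'. n < N \<Longrightarrow> R n lam' (P n lam') (l n lam') (Lam n lam')"
    by metis
  \<comment> \<open>Time reversal: \<open>revlam m\<close> is the adjoint variable at index
    \<open>N - m\<close>, so passing from \<open>m\<close> to \<open>Suc m\<close> crosses step
    \<open>N - Suc m\<close>.\<close>
  define revlam where "revlam = rec_nat g (\<lambda>m. P (N - Suc m))"
  define lam where "lam n = revlam (N - n)" for n
  have lam: "lam n = P n (lam (Suc n))" if "n < N" for n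
  proof -
    have "N - n = Suc (N - Suc n)" "N - Suc (N - Suc n) = n" using that by auto
    then show ?thesis by (simp add: lam_def revlam_def)
  qed
  have "lam N = g" by (simp add: lam_def revlam_def)
  have "adjoint_rk abar b c t N f C p z X lam (\<lambda>n. l n (lam (Suc n))) (\<lambda>n. Lam n (lam (Suc n)))"
    unfolding adjoint_rk_def rk_scheme_def
  proof (intro conjI allI impI)
    show "GDERIV C z :> lam N" using grad \<open>lam N = g\<close> by (simp only:)
    fix n i assume n: "n < N"
    note eqs = R[OF n, of "lam (Suc n)", folded lam[OF n], unfolded R_def]
    from eqs show "lam (Suc n) = lam n + step t n *\<^sub>R (\<Sum>i\<in>UNIV. b i *\<^sub>R l n (lam (Suc n)) i)" by (rule conjunct1)
    from eqs show "l n (lam (Suc n)) i = - ?B n i (Lam n (lam (Suc n)) i)" by (elim conjE allE)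
    from eqs show "Lam n (lam (Suc n)) i = lam n + step t n *\<^sub>R (\<Sum>j\<in>UNIV. abar i j *\<^sub>R l n (lam (Suc n)) j)"
      by (elim conjE allE)
  qed
  then show ?thesis by blast
qed

section \<open>The gradient of the cost by linearisation and duality\<close>

lemma GDERIV_rk_final:
  assumes b: "\<And>i. b i \<noteq> 0" and abar: "\<And>i j. abar i j = b j - a j i * b j / b i"
    and fwd: "forward_rk a b c t N f x0 p x k X"
    and adj: "adjoint_rk abar b c t N f C p (x N) X lam l Lam"
  shows "GDERIV (\<lambda>q. C (rk_final a b c t N f x0 q)) p :>
    (\<Sum>n<N. step t n *\<^sub>R (\<Sum>i\<in>UNIV. b i *\<^sub>R (transpose (d_p f (X n i) p (t n + c i * step t n)) *v Lam n i)))"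
proof -
  \<comment> \<open>Differentiation compares neighbouring parameters, so a solution is fixed for
    every \<open>q\<close>; at \<open>q = p\<close> uniqueness identifies its iterates and stages
    with the given ones.\<close>
  obtain xx kk XX where fwds: "\<And>q. forward_rk a b c t N f x0 q (xx q) (kk q) (XX q)"
    using forward_rk_exists by metis
  let ?\<tau> = "\<lambda>n i. t n + c i * step t n"
  \<comment> \<open>Defined before differentiability is known, which the facts below supply;
    \<open>\<kappa>\<close> is what the chain rule predicts for the slopes.\<close>
  define \<delta> where "\<delta> n = frechet_derivative (\<lambda>q. xx q n) (at p)" for n
  define \<xi> where "\<xi> n i = frechet_derivative (\<lambda>q. XX q n i) (at p)" for n i
  define \<kappa> where "\<kappa> n i v = d_x f (XX p n i) p (?\<tau> n i) *v \<xi> n i v + d_p f (XX p n i) p (?\<tau> n i) *v v" for n i v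
  have XX_diff: "(\<lambda>q. XX q n i) differentiable (at p)"
    if n: "n < N" and "(\<lambda>q. xx q n) differentiable (at p)" for n i
  proof (rule stages_differentiable[OF _ lip[OF n] step[OF n] L small[OF n] \<theta>[OF n] that(2) forward_rk_stages[OF fwds n]])
    show "(\<lambda>y. f (fst y) (snd y) (?\<tau> n j)) differentiable (at z)" for j z
      using deriv[OF n, of j "fst z" "snd z"] by (auto simp: differentiable_def)
  qed
  have kk_deriv: "((\<lambda>q. kk q n i) has_derivative \<kappa> n i) (at p)"
    if n: "n < N" and "(\<lambda>q. xx q n) differentiable (at p)" for n i
  proof -
    have "((\<lambda>q. XX q n i) has_derivative \<xi> n i) (at p)"
      unfolding \<xi>_def using XX_diff[OF that] by (simp add: frechet_derivative_works)
    then have "((\<lambda>q. (XX q n i, q)) has_derivative (\<lambda>v. (\<xi> n i v, v))) (at p)"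
      by (intro has_derivative_Pair derivative_intros)
    from diff_chain_at[OF this deriv[OF n]] show ?thesis
      by (simp add: o_def \<kappa>_def[abs_def] forward_rkD(2)[OF fwds n])
  qed
  \<comment> \<open>The weights stay free: \<open>w = b\<close> gives the next iterate,
    \<open>w = a i\<close> the stage \<open>i\<close>.\<close>
  have step_deriv: "((\<lambda>q. xx q n + step t n *\<^sub>R (\<Sum>i\<in>UNIV. w i *\<^sub>R kk q n i)) has_derivative
      (\<lambda>v. \<delta> n v + step t n *\<^sub>R (\<Sum>i\<in>UNIV. w i *\<^sub>R \<kappa> n i v))) (at p)"
    if n: "n < N" and "(\<lambda>q. xx q n) differentiable (at p)" for n w
    using that(2) unfolding \<delta>_def
    by (intro has_derivative_add has_derivative_scaleR_right has_derivative_sum kk_deriv n)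
       (simp_all add: frechet_derivative_works)
  have xx_diff: "(\<lambda>q. xx q n) differentiable (at p)" if "n \<le> N" for n
    using that
  proof (induction n)
    case 0
    then show ?case using fwds by (simp add: forward_rk_def)
  next
    case (Suc n)
    then have n: "n < N" and d: "(\<lambda>q. xx q n) differentiable (at p)" by simp_all
    show ?case
      using step_deriv[OF n d, of b] unfolding forward_rkD(1)[OF fwds n, symmetric]
      by (auto simp: differentiable_def)
  qed
  have \<delta>: "((\<lambda>q. xx q n) has_derivative \<delta> n) (at p)" if "n \<le> N" for n
    unfolding \<delta>_def using xx_diff[OF that] by (simp add: frechet_derivative_works)
  \<comment> \<open>The initial value does not depend on the parameter.\<close>
  have \<delta>0: "\<delta> 0 v = 0" for v
    using fwds by (simp add: \<delta>_def forward_rk_def)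
  \<comment> \<open>Derivatives are unique, so the linearised scheme can be read off from the
    forward one.\<close>
  have \<delta>_Suc: "\<delta> (Suc n) v = \<delta> n v + step t n *\<^sub>R (\<Sum>i\<in>UNIV. b i *\<^sub>R \<kappa> n i v)" if n: "n < N" for n v
    using has_derivative_unique[OF \<delta>[of "Suc n"], unfolded forward_rkD(1)[OF fwds n], OF _ step_deriv[OF n xx_diff]] n
    by simp
  have \<xi>: "\<xi> n i v = \<delta> n v + step t n *\<^sub>R (\<Sum>j\<in>UNIV. a i j *\<^sub>R \<kappa> n j v)" if n: "n < N" for n i v
    using frechet_derivative_at[OF step_deriv[OF n xx_diff, of "a i"]] n
    unfolding \<xi>_def forward_rkD(3)[OF fwds n] by (simp add: fun_eq_iff)
  have X: "XX p n = X n" if "n < N" for n by (rule forward_rk_unique(2)[OF fwds fwd that])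
  have xN: "xx p N = x N" by (rule forward_rk_unique(1)[OF fwds fwd]) simp
  have adjD: "lam (Suc n) = lam n + step t n *\<^sub>R (\<Sum>i\<in>UNIV. b i *\<^sub>R l n i)"
    "l n i = - (transpose (d_x f (X n i) p (?\<tau> n i)) *v Lam n i)"
    "Lam n i = lam n + step t n *\<^sub>R (\<Sum>j\<in>UNIV. abar i j *\<^sub>R l n j)" if "n < N" for n i
    using adj that unfolding adjoint_rk_def rk_scheme_def by blast+
  let ?S = "\<Sum>n<N. step t n *\<^sub>R (\<Sum>i\<in>UNIV. b i *\<^sub>R (transpose (d_p f (X n i) p (?\<tau> n i)) *v Lam n i))"
  have "\<delta> N v \<bullet> lam N = v \<bullet> ?S" for v
  proof -
    have "lam (Suc n) \<bullet> \<delta> (Suc n) v - lam n \<bullet> \<delta> n v =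
        v \<bullet> (step t n *\<^sub>R (\<Sum>i\<in>UNIV. b i *\<^sub>R (transpose (d_p f (X n i) p (?\<tau> n i)) *v Lam n i)))"
      if n: "n < N" for n
    proof -
      have "Lam n i \<bullet> \<kappa> n i v + l n i \<bullet> \<xi> n i v = v \<bullet> (transpose (d_p f (X n i) p (?\<tau> n i)) *v Lam n i)" for i
        by (subst inner_commute[of v]) (simp add: adjD(2)[OF n] \<kappa>_def X[OF n] dot_lmul_matrix inner_add_right)
      with adjoint_step_duality[OF b abar \<delta>_Suc[OF n] \<xi>[OF n] adjD(1)[OF n] adjD(3)[OF n], of v]
      show ?thesis by (simp add: inner_sum_right)
    qed
    then have "(\<Sum>n<N. lam (Suc n) \<bullet> \<delta> (Suc n) v - lam n \<bullet> \<delta> n v) = v \<bullet> ?S"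
      by (simp add: inner_sum_right)
    then show ?thesis
      by (simp add: sum_lessThan_telescope[of "\<lambda>n. lam n \<bullet> \<delta> n v"] \<delta>0 inner_commute)
  qed
  moreover have "(C has_derivative (\<lambda>v. v \<bullet> lam N)) (at (xx p N))"
    using adj by (simp add: adjoint_rk_def gderiv_def xN)
  from diff_chain_at[OF \<delta>[OF order_refl] this]
  have "((\<lambda>q. C (rk_final a b c t N f x0 q)) has_derivative (\<lambda>v. \<delta> N v \<bullet> lam N)) (at p)"
    by (simp add: o_def rk_final_eq[OF fwds])
  ultimately show ?thesis by (simp add: gderiv_def)
qed

end

section \<open>From the hypotheses on \<open>f\<close>, \<open>C\<close> and the grid to the
  contraction condition and the gradient formula\<close>

text \<open>The first-order case of smoothness gives a derivative \<open>C'\<close>, and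
  \<open>adjoint C' 1\<close> is its Riesz representative.\<close>

lemma smooth_imp_GDERIV:
  fixes C :: "'a::euclidean_space \<Rightarrow> real"
  assumes "smooth C"
  shows "\<exists>g. GDERIV C z :> g"
proof -
  have "Ck_class (Suc 0) C" using assms by (simp only: smooth_def)
  then obtain C' where C': "(C has_derivative C') (at z)" by (auto simp: differentiable_def)
  then have "linear C'" by (rule has_derivative_linear)
  then have "C' = (\<lambda>v. v \<bullet> adjoint C' 1)" by (simp add: fun_eq_iff adjoint_works)
  with C' show ?thesis unfolding gderiv_def by metis
qed

theorem theorem2p7:
  fixes a abar :: "'s::finite \<Rightarrow> 's \<Rightarrow> real"
    and b c bbar cbar :: "'s \<Rightarrow> real"
    and t :: "nat \<Rightarrow> real" and T L :: real and N :: nat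
    and f :: "real^'nx \<Rightarrow> real^'np \<Rightarrow> real \<Rightarrow> real^'nx"
    and C :: "real^'nx \<Rightarrow> real"
    and x0 :: "real^'nx"
  assumes N: "N \<ge> 1"
    and grid: "t 0 = 0" "\<And>n. n < N \<Longrightarrow> t n < t (Suc n)" "t N = T"
    and C: "smooth C"
    and f_lipschitz: "\<And>p. L-lipschitz_on (UNIV \<times> {0..T}) (\<lambda>(x, \<tau>). f x p \<tau>)"
    and f_diff_x: "\<And>x p \<tau>. \<tau> \<in> {0..T} \<Longrightarrow> (\<lambda>y. f y p \<tau>) differentiable (at x)"
    and f_diff_p: "\<And>x p \<tau>. \<tau> \<in> {0..T} \<Longrightarrow> (\<lambda>q. f x q \<tau>) differentiable (at p)"
    and d_x_cont: "continuous_on (UNIV \<times> UNIV \<times> {0..T}) (\<lambda>(x, p, \<tau>). d_x f x p \<tau>)"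
    and d_p_cont: "continuous_on (UNIV \<times> UNIV \<times> {0..T}) (\<lambda>(x, p, \<tau>). d_p f x p \<tau>)"
    and times: "\<And>n i. n < N \<Longrightarrow> t n + c i * step t n \<in> {0..T}"
    and b_nonzero: "\<And>i. b i \<noteq> 0"
    and step_size: "\<And>n. n < N \<Longrightarrow> L * (MAX i. \<Sum>j\<in>UNIV. \<bar>a i j\<bar>) > 0 \<Longrightarrow>
          step t n < 1 / (L * (MAX i. \<Sum>j\<in>UNIV. \<bar>a i j\<bar>))"
    and abar: "\<And>i j. abar i j = b j - a j i * b j / b i"
    and bbar: "\<And>i. bbar i = b i"
    and cbar: "\<And>i. cbar i = c i"
  shows "\<forall>p. (\<exists>x k X. forward_rk a b c t N f x0 p x k X) \<and>
    (\<forall>x k X. forward_rk a b c t N f x0 p x k X \<longrightarrow>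
      (\<exists>lam l Lam. adjoint_rk abar bbar cbar t N f C p (rk_final a b c t N f x0 p) X lam l Lam) \<and>
      (\<forall>lam l Lam. adjoint_rk abar bbar cbar t N f C p (rk_final a b c t N f x0 p) X lam l Lam \<longrightarrow>
        (GDERIV (\<lambda>q. C (rk_final a b c t N f x0 q)) p :>
          (\<Sum>n<N. step t n *\<^sub>R (\<Sum>i\<in>UNIV. bbar i *\<^sub>R
             (transpose (d_p f (X n i) p (t n + cbar i * step t n)) *v Lam n i))))))"
proof -
  define A where "A = (MAX i. \<Sum>j\<in>UNIV. \<bar>a i j\<bar>)"
  have rows: "(\<Sum>j\<in>UNIV. \<bar>a i j\<bar>) \<le> A" for i unfolding A_def by (intro Max_ge) auto
  have L: "0 \<le> L" using f_lipschitz by (rule lipschitz_on_nonneg)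
  have step: "0 \<le> step t n" if "n < N" for n using grid(2)[OF that] by (simp add: step_def)
  \<comment> \<open>The contraction factor of a step is its length times \<open>L * A\<close>, with
    \<open>A\<close> the largest absolute row sum.\<close>
  interpret contractive_rk a b c t N f x0 L "\<lambda>n. step t n * (L * A)"
  proof
    show "0 \<le> L" by (rule L)
    fix n assume n: "n < N"
    show "0 \<le> step t n" by (rule step[OF n])
    show "step t n * (L * A) < 1"
    proof (cases "L * A > 0")
      case True
      with step_size[OF n, folded A_def] show ?thesis by (simp add: field_simps)
    next
      \<comment> \<open>The step-size condition is void here, but the contraction factor is then at
        most 0.\<close>
      case False
      then have "step t n * (L * A) \<le> 0" using step[OF n] by (simp add: mult_nonneg_nonpos)
      then show ?thesis by simp
    qed
    fix i
    have "(\<Sum>j\<in>UNIV. step t n * L * \<bar>a i j\<bar>) = step t n * (L * (\<Sum>j\<in>UNIV. \<bar>a i j\<bar>))"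
      by (simp add: sum_distrib_left mult.assoc)
    also have "\<dots> \<le> step t n * (L * A)" by (intro mult_left_mono rows L step n)
    finally show "(\<Sum>j\<in>UNIV. step t n * L * \<bar>a i j\<bar>) \<le> step t n * (L * A)" .
    let ?\<tau> = "t n + c i * step t n"
    have \<tau>: "?\<tau> \<in> {0..T}" by (rule times[OF n])
    show "norm (f x p ?\<tau> - f y p ?\<tau>) \<le> L * norm (x - y)" for x y p
      using lipschitz_onD[OF f_lipschitz[of p], of "(x, ?\<tau>)" "(y, ?\<tau>)"] \<tau>
      by (simp add: dist_Pair_Pair dist_norm)
    \<comment> \<open>Freezing the time at a stage turns continuity in all three arguments into
      joint continuity in \<open>(x, p)\<close>.\<close>
    have "continuous_on UNIV (\<lambda>z. (\<lambda>(x, p, \<tau>). d_p f x p \<tau>) (fst z, snd z, ?\<tau>))"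
      using \<tau> by (intro continuous_on_compose2[OF d_p_cont] continuous_intros) auto
    then have "continuous_on UNIV (\<lambda>(x, p). jacobian (\<lambda>q. f x q ?\<tau>) (at p))"
      by (simp add: d_p_def case_prod_unfold)
    then show "((\<lambda>z. f (fst z) (snd z) ?\<tau>) has_derivative
        (\<lambda>v. d_x f x p ?\<tau> *v fst v + d_p f x p ?\<tau> *v snd v)) (at (x, p))" for x p
      unfolding d_x_def d_p_def
      by (intro has_derivative_jacobian_partials f_diff_x f_diff_p \<tau>)
  qed
  have coeffs: "bbar = b" "cbar = c" by (simp_all add: fun_eq_iff bbar cbar)
  show ?thesis
    unfolding coeffs
  proof (intro allI conjI impI)
    fix p
    show "\<exists>x k X. forward_rk a b c t N f x0 p x k X" by (rule forward_rk_exists)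
    fix x k X assume fwd: "forward_rk a b c t N f x0 p x k X"
    show "\<exists>lam l Lam. adjoint_rk abar b c t N f C p (rk_final a b c t N f x0 p) X lam l Lam"
      using smooth_imp_GDERIV[OF C] adjoint_rk_exists[OF b_nonzero abar] by blast
    fix lam l Lam assume "adjoint_rk abar b c t N f C p (rk_final a b c t N f x0 p) X lam l Lam"
    then show "GDERIV (\<lambda>q. C (rk_final a b c t N f x0 q)) p :>
        (\<Sum>n<N. step t n *\<^sub>R (\<Sum>i\<in>UNIV. b i *\<^sub>R (transpose (d_p f (X n i) p (t n + c i * step t n)) *v Lam n i)))"
      unfolding rk_final_eq[OF fwd] by (rule GDERIV_rk_final[OF b_nonzero abar fwd])
  qed
qed

end
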